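(* Let $n\geqslant 1$ be an integer and let $(a_1,\ldots,a_{n+1})$ and $(b_1,\ldots,b_n)$ be two sequences of positive integers such that: (1) $a_1$ and $a_{n+1}$ are odd, while $a_2,\ldots,a_n$ are even; (2) for every $I\subseteq[n]=\{1,\dots,n\}$ we have $\sum_{i\in I}b_i\neq \sum_{i\notin I}b_i$. Then the binary word $$W=\mathtt{1}^{a_1}\mathtt{0}^{b_1}\mathtt{1}^{a_2}\mathtt{0}^{b_2}\mathtt{1}^{a_3}\cdots\mathtt{1}^{a_n}\mathtt{0}^{b_n}\mathtt{1}^{a_{n+1}}$$ is not a shuffle square.
   Context: A word is a finite sequence of letters; $w^r$ denotes $r$ consecutive copies of the letter $w$, and concatenation is juxtaposition. A subword of $W=w_1\cdots w_N$ is a subsequence $w_{i_1}\cdots w_{i_t}$ ($i_1<\dots<i_t$), with support $\{i_1,\dots,i_t\}$. A word $W$ is a shuffle square if its positions can be partitioned into the supports of two subwords $X$ and $Y$ that are equal as words (i.e. $W$ consists of two shuffled copies of the same word). *)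

theory Defs
  imports Main
begin

(* Positions are counted from 0; nths W A is the subword of W with support A. *)
definition shuffle_square :: "'a list \<Rightarrow> bool" where
  "shuffle_square W \<longleftrightarrow>
     (\<exists>A B. A \<union> B = {..<length W} \<and> A \<inter> B = {} \<and> nths W A = nths W B)"

(* 1^(a 1) 0^(b 1) 1^(a 2) 0^(b 2) ... 1^(a n) 0^(b n) 1^(a (n+1)),
   a word over the letters 0 and 1; the values of a and b at other indices play no role. *)
definition block_word :: "nat \<Rightarrow> (nat \<Rightarrow> nat) \<Rightarrow> (nat \<Rightarrow> nat) \<Rightarrow> nat list" where
  "block_word n a b =
     concat (map (\<lambda>i. replicate (a i) 1 @ replicate (b i) 0) [1..<n + 1])
       @ replicate (a (n + 1)) 1"

end

theory Submission
  imports Defs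
begin

text \<open>
  Split the word into complementary subwords \<open>X\<close> and \<open>Y\<close>. An odd number of ones precedes each
  block of zeros, so at that block the numbers of ones already placed in \<open>X\<close> and in \<open>Y\<close> have
  opposite parities. Let \<open>I\<close> collect the blocks at which the number for \<open>X\<close> is even. The zeros
  of the blocks in \<open>I\<close> are then the zeros of \<open>X\<close> preceded by evenly many ones together with the
  zeros of \<open>Y\<close> preceded by oddly many, and the zeros of the remaining blocks are obtained by
  exchanging \<open>X\<close> and \<open>Y\<close>. If \<open>X = Y\<close>, both totals agree, against hypothesis (2).
\<close>

text \<open>The flag \<open>True\<close> selects the zeros preceded by evenly many ones.\<close>
fun zeros_at_parity :: "bool \<Rightarrow> nat list \<Rightarrow> nat" where
  "zeros_at_parity p [] = 0"
| "zeros_at_parity p (x # xs) =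
     (if x = 0 then of_bool p + zeros_at_parity p xs else zeros_at_parity (\<not> p) xs)"

definition ones :: "nat list \<Rightarrow> nat" where
  "ones xs = length (filter (\<lambda>x. x \<noteq> 0) xs)"

lemma ones_simps [simp]:
  "ones [] = 0"
  "ones (xs @ ys) = ones xs + ones ys"
  "ones (replicate k 0) = 0"
  "ones (replicate k (Suc 0)) = k"
  by (simp_all add: ones_def)

text \<open>Each nonzero letter of \<open>xs\<close> flips the flag, so \<open>ys\<close> starts
  with \<open>p\<close> after evenly many of them and with \<open>\<not> p\<close> otherwise; the
  equation \<open>p = even (ones xs)\<close> encodes both cases.\<close>

lemma zeros_at_parity_append:
  "zeros_at_parity p (xs @ ys) =
     zeros_at_parity p xs + zeros_at_parity (p = even (ones xs)) ys"
proof (induction p xs rule: zeros_at_parity.induct)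
  case (2 p x xs)
  then show ?case by (cases p) (simp_all add: ones_def)
qed (simp add: ones_def)

lemma zeros_at_parity_replicate [simp]:
  "zeros_at_parity p (replicate k 0) = (if p then k else 0)"
  "zeros_at_parity p (replicate k (Suc 0)) = 0"
  by (induction k arbitrary: p) auto

lemma zeros_at_parity_append_block:
  "zeros_at_parity p (xs @ replicate c (Suc 0) @ replicate d 0) =
     zeros_at_parity p xs + (if p = even (ones xs + c) then d else 0)"
  unfolding append_assoc[symmetric] zeros_at_parity_append by simp

lemma nths_replicate_split:
  obtains c d where "nths (replicate k x) A = replicate c x"
    and "nths (replicate k x) (- A) = replicate d x" and "c + d = k"
proof -
  have "\<exists>c d. nths (replicate k x) A = replicate c x \<and>
          nths (replicate k x) (- A) = replicate d x \<and> c + d = k"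
  proof (induction k arbitrary: A)
    case 0
    show ?case by simp
  next
    case (Suc k)
    have "{j. Suc j \<in> - A} = - {j. Suc j \<in> A}" by auto
    with Suc[of "{j. Suc j \<in> A}"] obtain c d where
      "nths (replicate k x) {j. Suc j \<in> A} = replicate c x"
      "nths (replicate k x) {j. Suc j \<in> - A} = replicate d x" "c + d = k"
      by auto
    then have "nths (replicate (Suc k) x) A = replicate (if 0 \<in> A then Suc c else c) x"
      "nths (replicate (Suc k) x) (- A) = replicate (if 0 \<in> A then d else Suc d) x"
      by (simp_all add: nths_Cons)
    moreover have "(if 0 \<in> A then Suc c else c) + (if 0 \<in> A then d else Suc d) = Suc k"
      using \<open>c + d = k\<close> by simp
    ultimately show ?case by blast
  qed
  with that show thesis by blast
qed

text \<open>Keeps the support in the form of a complement when it is shifted, so that one set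
  describes both subwords of every suffix.\<close>

lemma nths_complement_append:
  "nths (xs @ ys) (- A) = nths xs (- A) @ nths ys (- {j. j + length xs \<in> A})"
proof -
  have "{j. j + length xs \<in> - A} = - {j. j + length xs \<in> A}" by auto
  then show ?thesis by (simp add: nths_append)
qed

text \<open>Positions beyond the word do not affect \<open>nths\<close>. Passing to
  \<open>- A\<close> frees the pair of supports from the length of the word, so the same
  \<open>A\<close> also splits every prefix.\<close>

lemma nths_eq_complement:
  assumes "A \<union> B = {..<length W}" and "A \<inter> B = {}"
  shows "nths W B = nths W (- A)"
proof -
  have "i \<in> B \<longleftrightarrow> i \<in> - A" if "i < length W" for i
    using assms that by blast
  then show ?thesis
    unfolding nths_def
    by (intro arg_cong[of _ _ "map fst"] filter_cong) (auto simp: in_set_zip)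
qed

lemma nths_block_append:
  fixes P :: "nat list"
  obtains c c' d d' where
    "nths (P @ replicate k 1 @ replicate l 0) A = nths P A @ replicate c 1 @ replicate d 0"
    "nths (P @ replicate k 1 @ replicate l 0) (- A) = nths P (- A) @ replicate c' 1 @ replicate d' 0"
    "c + c' = k" "d + d' = l"
proof -
  \<comment> \<open>\<open>A1\<close> and \<open>A2\<close> are \<open>A\<close> re-indexed from the
    start of the new ones and of the new zeros.\<close>
  define A1 where "A1 = {j. j + length P \<in> A}"
  define A2 where "A2 = {j. j + k \<in> A1}"
  obtain c c' where "nths (replicate k (1::nat)) A1 = replicate c 1"
      "nths (replicate k (1::nat)) (- A1) = replicate c' 1" "c + c' = k"
    by (rule nths_replicate_split)
  moreover obtain d d' where "nths (replicate l (0::nat)) A2 = replicate d 0"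
      "nths (replicate l (0::nat)) (- A2) = replicate d' 0" "d + d' = l"
    by (rule nths_replicate_split)
  ultimately show thesis
    using that[of c d c' d']
    by (simp add: nths_append[of _ _ A] nths_append[of _ _ A1] nths_complement_append
        flip: A1_def A2_def)
qed

text \<open>Induction on the number of blocks. The count of ones is carried along because, with the
  odd prefix sums, it forces opposite parities in the two subwords at the next block of
  zeros.\<close>

lemma blocks_split:
  fixes a b :: "nat \<Rightarrow> nat"
  defines "P m \<equiv> concat (map (\<lambda>i. replicate (a i) 1 @ replicate (b i) 0) [1..<m + 1])"
  assumes odd: "\<And>i. i \<in> {1..m} \<Longrightarrow> odd (\<Sum>j=1..i. a j)"
  shows "ones (nths (P m) A) + ones (nths (P m) (- A)) = (\<Sum>j=1..m. a j) \<and>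
    (\<exists>I\<subseteq>{1..m}.
      zeros_at_parity True (nths (P m) A) + zeros_at_parity False (nths (P m) (- A)) = sum b I \<and>
      zeros_at_parity False (nths (P m) A) + zeros_at_parity True (nths (P m) (- A)) =
        sum b ({1..m} - I))"
  using odd
proof (induction m)
  case 0
  show ?case by (simp add: P_def)
next
  case (Suc m)
  let ?X = "nths (P m) A" and ?Y = "nths (P m) (- A)"
  have P: "P (Suc m) = P m @ replicate (a (Suc m)) 1 @ replicate (b (Suc m)) 0"
    by (simp add: P_def)
  obtain c c' d d' where X: "nths (P (Suc m)) A = ?X @ replicate c 1 @ replicate d 0"
    and Y: "nths (P (Suc m)) (- A) = ?Y @ replicate c' 1 @ replicate d' 0"
    and c: "c + c' = a (Suc m)" and d: "d + d' = b (Suc m)"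
    unfolding P by (rule nths_block_append)
  have "odd (\<Sum>j=1..i. a j)" if "i \<in> {1..m}" for i
    using Suc.prems that by simp
  from Suc.IH[OF this] obtain I where total: "ones ?X + ones ?Y = (\<Sum>j=1..m. a j)" and I: "I \<subseteq> {1..m}"
    and even: "zeros_at_parity True ?X + zeros_at_parity False ?Y = sum b I"
    and odd: "zeros_at_parity False ?X + zeros_at_parity True ?Y = sum b ({1..m} - I)"
    by blast
  have total': "(ones ?X + c) + (ones ?Y + c') = (\<Sum>j=1..Suc m. a j)"
    using total c by simp
  have parity: "even (ones ?Y + c') \<longleftrightarrow> odd (ones ?X + c)"
    using Suc.prems[of "Suc m"] unfolding total'[symmetric] by auto
  \<comment> \<open>\<open>e\<close> decides whether the new block joins the index set.\<close>
  define e where "e \<longleftrightarrow> even (ones ?X + c)"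
  have zeros_X: "zeros_at_parity p (nths (P (Suc m)) A) =
      zeros_at_parity p ?X + (if p = e then d else 0)" for p
    unfolding e_def X One_nat_def by (rule zeros_at_parity_append_block)
  have zeros_Y: "zeros_at_parity p (nths (P (Suc m)) (- A)) =
      zeros_at_parity p ?Y + (if p = (\<not> e) then d' else 0)" for p
    unfolding e_def Y One_nat_def parity[symmetric] by (rule zeros_at_parity_append_block)
  have "finite I" using I finite_subset by blast
  have "Suc m \<notin> I" using I by auto
  \<comment> \<open>By the opposite parities, \<open>d\<close> and \<open>d'\<close> always enter
    the same one of the two totals: the first if \<open>e\<close> holds, the second otherwise. So
    the whole \<open>b (Suc m)\<close> goes to one side.\<close>
  have "\<exists>J\<subseteq>{1..Suc m}.
      zeros_at_parity True (nths (P (Suc m)) A) + zeros_at_parity False (nths (P (Suc m)) (- A))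
        = sum b J \<and>
      zeros_at_parity False (nths (P (Suc m)) A) + zeros_at_parity True (nths (P (Suc m)) (- A))
        = sum b ({1..Suc m} - J)"
  proof (cases e)
    case True
    have "insert (Suc m) I \<subseteq> {1..Suc m}" using I by auto
    moreover have "{1..Suc m} - insert (Suc m) I = {1..m} - I" by auto
    moreover have "sum b (insert (Suc m) I) = sum b I + d + d'"
      using d \<open>finite I\<close> \<open>Suc m \<notin> I\<close> by simp
    ultimately show ?thesis
      unfolding zeros_X zeros_Y using True even odd
      by (intro exI[of _ "insert (Suc m) I"]) simp
  next
    case False
    have "I \<subseteq> {1..Suc m}" using I by auto
    moreover have "{1..Suc m} - I = insert (Suc m) ({1..m} - I)" using \<open>Suc m \<notin> I\<close> by auto
    then have "sum b ({1..Suc m} - I) = sum b ({1..m} - I) + d + d'"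
      using d by simp
    ultimately show ?thesis
      unfolding zeros_X zeros_Y using False even odd
      by (intro exI[of _ I]) simp
  qed
  with total' show ?case by (simp add: X Y)
qed

theorem theorem1p2:
  fixes n :: nat and a b :: "nat \<Rightarrow> nat"
  assumes "n \<ge> 1"
    and "\<forall>i\<in>{1..n + 1}. a i > 0"
    and "\<forall>i\<in>{1..n}. b i > 0"
    and "odd (a 1)" and "odd (a (n + 1))" and "\<forall>i\<in>{2..n}. even (a i)"
    and "\<forall>I. I \<subseteq> {1..n} \<longrightarrow> (\<Sum>i\<in>I. b i) \<noteq> (\<Sum>i\<in>{1..n} - I. b i)"
  shows "\<not> shuffle_square (block_word n a b)"
proof
  define P where "P = concat (map (\<lambda>i. replicate (a i) 1 @ replicate (b i) (0::nat)) [1..<n + 1])"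
  assume "shuffle_square (block_word n a b)"
  then obtain A where "nths (block_word n a b) A = nths (block_word n a b) (- A)"
    unfolding shuffle_square_def using nths_eq_complement by metis
  \<comment> \<open>The final run of ones is treated as a block with an empty run of zeros.\<close>
  moreover obtain c c' d d' where
    "nths (P @ replicate (a (n + 1)) 1 @ replicate 0 0) A = nths P A @ replicate c 1 @ replicate d 0"
    "nths (P @ replicate (a (n + 1)) 1 @ replicate 0 0) (- A) =
       nths P (- A) @ replicate c' 1 @ replicate d' 0"
    "d + d' = 0"
    by (rule nths_block_append)
  ultimately have "nths P A @ replicate c 1 = nths P (- A) @ replicate c' 1"
    by (simp add: block_word_def P_def)
  then have "zeros_at_parity p (nths P A @ replicate c 1) =
      zeros_at_parity p (nths P (- A) @ replicate c' 1)" for p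
    by simp
  then have same: "zeros_at_parity p (nths P A) = zeros_at_parity p (nths P (- A))" for p
    by (simp add: zeros_at_parity_append)
  have "odd (\<Sum>j=1..i. a j)" if "i \<in> {1..n}" for i
  proof -
    have "(\<Sum>j=1..i. a j) = a 1 + (\<Sum>j=2..i. a j)"
      using that by (simp add: sum.atLeast_Suc_atMost numeral_2_eq_2)
    moreover have "even (\<Sum>j=2..i. a j)"
      using that assms(6) by (intro dvd_sum) auto
    ultimately show ?thesis using assms(4) by simp
  qed
  from blocks_split[of n a b A, OF this] obtain I where "I \<subseteq> {1..n}"
    "zeros_at_parity True (nths P A) + zeros_at_parity False (nths P (- A)) = sum b I"
    "zeros_at_parity False (nths P A) + zeros_at_parity True (nths P (- A)) = sum b ({1..n} - I)"
    unfolding P_def by blast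
  \<comment> \<open>By \<open>same\<close>, exchanging the two subwords turns the first total into
    the second, so \<open>I\<close> balances the \<open>b i\<close>.\<close>
  with same assms(7) show False by (metis add.commute)
qed

end
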